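(* Let $W(E_6)$ be the Weyl group of type $E_6$ with simple reflections $w_1,\dots,w_6$ labelled as in the context, and let $\mathfrak{S}_6$ denote the parabolic subgroup generated by $w_1,w_3,w_4,w_5,w_6$. Then a complete set of representatives of the double cosets $\mathfrak{S}_6\backslash W(E_6)/\mathfrak{S}_6$ (one for each double coset) is given by the five elements $$\tau_1=\mathrm{id},\qquad \tau_2=w_2,\qquad \tau_3=w_2w_4w_3w_5w_4w_2,\qquad \tau_4=w_2w_4w_3w_1w_5w_4w_3w_6w_5w_4w_2,$$ $$\tau_5=w_2w_4w_3w_1w_5w_4w_2w_3w_4w_5w_6w_5w_4w_2w_3w_1w_4w_3w_5w_4w_2 .$$
   Context: The Dynkin diagram of $E_6$ is labelled as in Bourbaki: the nodes form the chain $1-3-4-5-6$, and node $2$ is attached to node $4$. (In the paper $W(E_6)$ arises as the symmetry group of the elliptic ${}_{10}E_9$ series, the subgroup $\mathfrak{S}_6$ corresponding to the permutations of the parameters $c_0,\dots,c_5$ and $w_2$ to the Bailey transformation.) *)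

theory Defs
  imports
    "HOL-Analysis.Finite_Cartesian_Product"
    "HOL-Library.Numeral_Type"
    "HOL-Algebra.Bij"
    "HOL-Algebra.Coset"
    "HOL-Algebra.Generated_Groups"
begin

section \<open>Weyl groups in the basis of simple roots\<close>

text \<open>
  A Cartan matrix \<open>A\<close> has entries \<open>A i j = \<langle>\<alpha>\<^sub>j, \<alpha>\<^sub>i\<^sup>\<or>\<rangle>\<close>. The Weyl group acts on the real vector
  space with the simple roots as basis, \<open>\<alpha>\<^sub>i = axis i 1\<close>, and the simple reflection
  \<open>s\<^sub>i(x) = x - \<langle>x, \<alpha>\<^sub>i\<^sup>\<or>\<rangle> \<alpha>\<^sub>i\<close> sends \<open>\<alpha>\<^sub>j\<close> to \<open>\<alpha>\<^sub>j - A i j \<alpha>\<^sub>i\<close>.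
\<close>

definition simple_reflection :: "('n::finite \<Rightarrow> 'n \<Rightarrow> int) \<Rightarrow> 'n \<Rightarrow> real ^ 'n \<Rightarrow> real ^ 'n" where
  "simple_reflection A i x = x - (\<Sum>j\<in>UNIV. of_int (A i j) * x $ j) *\<^sub>R axis i 1"

text \<open>
  The group operation is composition of maps, \<open>(g \<otimes> h) x = g (h x)\<close>.
\<close>

definition weyl_group :: "('n::finite \<Rightarrow> 'n \<Rightarrow> int) \<Rightarrow> (real ^ 'n \<Rightarrow> real ^ 'n) monoid" where
  "weyl_group A =
    (BijGroup UNIV)\<lparr>carrier := generate (BijGroup UNIV) (range (simple_reflection A))\<rparr>"

definition parabolic_subgroup ::
    "('n::finite \<Rightarrow> 'n \<Rightarrow> int) \<Rightarrow> 'n set \<Rightarrow> (real ^ 'n \<Rightarrow> real ^ 'n) set" where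
  "parabolic_subgroup A J = generate (weyl_group A) (simple_reflection A ` J)"

definition weyl_word :: "('n::finite \<Rightarrow> 'n \<Rightarrow> int) \<Rightarrow> 'n list \<Rightarrow> real ^ 'n \<Rightarrow> real ^ 'n" where
  "weyl_word A is =
    foldr (\<lambda>i g. simple_reflection A i \<otimes>\<^bsub>weyl_group A\<^esub> g) is \<one>\<^bsub>weyl_group A\<^esub>"

lemma simple_reflection_axis:
  "simple_reflection A i (axis j 1) = axis j 1 - of_int (A i j) *\<^sub>R axis i 1"
proof -
  have "(\<Sum>k\<in>UNIV. real_of_int (A i k) * axis j 1 $ k)
      = (\<Sum>k\<in>UNIV. if k = j then real_of_int (A i k) else 0)"
    by (rule sum.cong) (auto simp: axis_def)
  then show ?thesis
    by (simp add: simple_reflection_def)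
qed

lemma simple_reflection_involutive:
  assumes "A i i = 2"
  shows "simple_reflection A i (simple_reflection A i x) = x"
proof -
  define c where "c = (\<Sum>j\<in>UNIV. real_of_int (A i j) * x $ j)"
  have "(\<Sum>j\<in>UNIV. real_of_int (A i j) * (x - c *\<^sub>R axis i 1) $ j)
      = c - (\<Sum>j\<in>UNIV. if j = i then real_of_int (A i j) * c else 0)"
    unfolding c_def sum_subtractf[symmetric]
    by (rule sum.cong) (auto simp: axis_def algebra_simps)
  also have "\<dots> = - c"
    using assms by simp
  finally show ?thesis
    by (simp add: simple_reflection_def flip: c_def)
qed

lemma group_weyl_group:
  assumes "\<And>i. A i i = 2"
  shows "group (weyl_group A)"
proof -
  have "range (simple_reflection A) \<subseteq> carrier (BijGroup UNIV)"
    using simple_reflection_involutive[of A, OF assms]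
    by (auto simp: BijGroup_def Bij_def extensional_def
        intro!: o_bij simp: fun_eq_iff)
  then show ?thesis
    unfolding weyl_group_def
    by (intro group.subgroup_imp_group group.generate_is_subgroup group_BijGroup)
qed


section \<open>Type \<open>E\<^sub>6\<close>\<close>

text \<open>
  The nodes are the elements \<open>1, \<dots>, 6\<close> of the six-element numeral type \<^typ>\<open>6\<close>; in this type
  \<open>6\<close> is the same element as \<open>0\<close>, and the six labels are pairwise distinct.
\<close>

definition edges_E6 :: "6 set set" where
  "edges_E6 = {{1, 3}, {3, 4}, {4, 5}, {5, 6}, {2, 4}}"

definition cartan_E6 :: "6 \<Rightarrow> 6 \<Rightarrow> int" where
  "cartan_E6 i j = (if i = j then 2 else if {i, j} \<in> edges_E6 then - 1 else 0)"

lemma labels_E6: "distinct [1, 2, 3, 4, 5, 6 :: 6]" "UNIV = {1, 2, 3, 4, 5, 6 :: 6}"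
proof -
  show d: "distinct [1, 2, 3, 4, 5, 6 :: 6]"
    by simp
  have "card {1, 2, 3, 4, 5, 6 :: 6} = CARD(6)"
    using distinct_card[OF d] by simp
  then show "UNIV = {1, 2, 3, 4, 5, 6 :: 6}"
    by (metis card_subset_eq finite_class.finite_UNIV subset_UNIV)
qed


section \<open>Double cosets\<close>

definition double_coset ::
    "('a, 'b) monoid_scheme \<Rightarrow> 'a set \<Rightarrow> 'a \<Rightarrow> 'a set \<Rightarrow> 'a set" where
  "double_coset G H x K = (H #>\<^bsub>G\<^esub> x) <#>\<^bsub>G\<^esub> K"

definition double_cosets ::
    "('a, 'b) monoid_scheme \<Rightarrow> 'a set \<Rightarrow> 'a set \<Rightarrow> 'a set set" where
  "double_cosets G H K = (\<lambda>x. double_coset G H x K) ` carrier G"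

definition double_coset_representatives ::
    "('a, 'b) monoid_scheme \<Rightarrow> 'a set \<Rightarrow> 'a set \<Rightarrow> 'a list \<Rightarrow> bool" where
  "double_coset_representatives G H K ts \<longleftrightarrow>
    set ts \<subseteq> carrier G \<and>
    bij_betw (\<lambda>k. double_coset G H (ts ! k) K) {..<length ts} (double_cosets G H K)"

end

theory Submission
  imports Defs
begin

text \<open>
  Let \<open>\<theta>\<close> be the highest root. Its coefficients \<open>1, 2, 2, 3, 2, 1\<close> make it orthogonal to every simple
  root except \<open>\<alpha>\<^sub>2\<close>, so it is dominant and its stabiliser in \<open>W = W(E\<^sub>6)\<close> is exactly \<open>H = \<SS>\<^sub>6\<close>
  (\<open>stabiliser_E6\<close>). Hence \<open>H w H \<mapsto> H (w \<theta>)\<close> is a bijection from the double cosets to the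
  \<open>H\<close>-orbits on \<open>W \<theta>\<close>, and it remains to see that the five \<open>\<tau>\<^sub>k \<theta>\<close> represent these orbits.

  They lie in different orbits because \<open>H\<close> does not change the coefficient of \<open>\<alpha>\<^sub>2\<close>, which takes the
  values \<open>2, 1, 0, -1, -2\<close> on them (\<open>double_coset_level\<close>). They meet every orbit because a vector
  of \<open>W \<theta>\<close> can be moved by \<open>H\<close> to one that pairs non-negatively with the simple coroots of the
  subdiagram \<open>A\<^sub>5\<close> (\<open>exists_A5_dominant_conjugate\<close>). Such a vector has integral coordinates and
  squared length \<open>2\<close>. Splitting it into its components orthogonal to \<open>A\<^sub>5\<close> and inside \<open>A\<^sub>5\<close> turns
  this into a quadratic equation in its \<open>\<alpha>\<^sub>2\<close>-coefficient and its five pairings that has only five solutions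
  (\<open>A5_dominant_in_list\<close>). These are the five vectors \<open>\<tau>\<^sub>k \<theta>\<close> (\<open>reps_highest_root\<close>).

  The stabiliser theorem is proved for every simply laced Cartan matrix and every dominant vector \<open>v\<close>,
  without positive roots or the length function: words that move \<open>v\<close> strictly downwards at every
  step satisfy an exchange property (\<open>descending_exchange\<close>), which follows by induction from the
  commutation and braid relations. Every element of \<open>W\<close> is therefore a descending word times an
  element of the parabolic subgroup orthogonal to \<open>v\<close>, and a non-empty descending word moves \<open>v\<close>.
\<close>

section \<open>Words in simple reflections\<close>

definition coroot_pairing :: "('n::finite \<Rightarrow> 'n \<Rightarrow> int) \<Rightarrow> 'n \<Rightarrow> real ^ 'n \<Rightarrow> real" where
  "coroot_pairing A i x = (\<Sum>j\<in>UNIV. of_int (A i j) * x $ j)"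

lemma simple_reflection_eq:
  "simple_reflection A i x = x - coroot_pairing A i x *\<^sub>R axis i 1"
  by (simp add: simple_reflection_def coroot_pairing_def)

lemma coroot_pairing_diff_axis:
  "coroot_pairing A i (x - c *\<^sub>R axis j 1) = coroot_pairing A i x - c * of_int (A i j)"
proof -
  have "coroot_pairing A i (x - c *\<^sub>R axis j 1)
      = coroot_pairing A i x - (\<Sum>k\<in>UNIV. if k = j then c * of_int (A i j) else 0)"
    unfolding coroot_pairing_def sum_subtractf[symmetric]
    by (rule sum.cong) (auto simp: axis_def algebra_simps)
  then show ?thesis by simp
qed

lemma coroot_pairing_simple_reflection:
  "coroot_pairing A i (simple_reflection A j x)
    = coroot_pairing A i x - coroot_pairing A j x * of_int (A i j)"
  by (simp add: simple_reflection_eq coroot_pairing_diff_axis)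

lemma simple_reflections_commute:
  assumes "A i j = 0" "A j i = 0"
  shows "simple_reflection A i (simple_reflection A j x)
    = simple_reflection A j (simple_reflection A i x)"
  by (simp add: simple_reflection_eq coroot_pairing_diff_axis assms)

lemma simple_reflections_braid:
  assumes "A i j = -1" "A j i = -1" "A i i = 2" "A j j = 2"
  shows "simple_reflection A i (simple_reflection A j (simple_reflection A i x))
    = simple_reflection A j (simple_reflection A i (simple_reflection A j x))"
  unfolding simple_reflection_eq coroot_pairing_diff_axis assms by (simp add: algebra_simps)

lemma simple_reflection_bij:
  assumes "\<And>i. A i i = 2"
  shows "simple_reflection A i \<in> carrier (BijGroup UNIV)"
  using involuntory_imp_bij[of "simple_reflection A i"] simple_reflection_involutive[of A, OF assms]
  by (simp add: BijGroup_def Bij_def extensional_def)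

lemma weyl_carrier_subset:
  assumes "\<And>i. A i i = 2"
  shows "carrier (weyl_group A) \<subseteq> carrier (BijGroup UNIV)"
proof -
  have "range (simple_reflection A) \<subseteq> carrier (BijGroup UNIV)"
    using simple_reflection_bij[of A, OF assms] by blast
  from group.generate_incl[OF group_BijGroup this] show ?thesis
    by (simp add: weyl_group_def)
qed

lemma weyl_mult:
  assumes "\<And>i. A i i = 2" "g \<in> carrier (weyl_group A)" "h \<in> carrier (weyl_group A)"
  shows "g \<otimes>\<^bsub>weyl_group A\<^esub> h = g \<circ> h"
proof -
  have "g \<in> carrier (BijGroup UNIV)" "h \<in> carrier (BijGroup UNIV)"
    using weyl_carrier_subset[of A, OF assms(1)] assms(2,3) by blast+
  then have "g \<in> Bij UNIV" "h \<in> Bij UNIV"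
    by (simp_all add: BijGroup_def)
  then show ?thesis
    by (simp add: weyl_group_def BijGroup_def compose_def restrict_def o_def)
qed

lemma weyl_one: "\<one>\<^bsub>weyl_group A\<^esub> = id"
  by (auto simp: weyl_group_def BijGroup_def fun_eq_iff)

lemma simple_reflection_in_weyl: "simple_reflection A i \<in> carrier (weyl_group A)"
  by (auto simp: weyl_group_def intro: generate.incl)

lemma weyl_word_in_weyl:
  assumes "\<And>i. A i i = 2"
  shows "weyl_word A is \<in> carrier (weyl_group A)"
proof -
  interpret group "weyl_group A" by (rule group_weyl_group[OF assms])
  show ?thesis
    by (induction "is") (auto simp: weyl_word_def simple_reflection_in_weyl)
qed

lemma weyl_word_Nil [simp]: "weyl_word A [] = id"
  by (simp add: weyl_word_def weyl_one)

lemma weyl_word_Cons: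
  assumes "\<And>i. A i i = 2"
  shows "weyl_word A (i # is) = simple_reflection A i \<circ> weyl_word A is"
  using weyl_mult[of A, OF assms simple_reflection_in_weyl weyl_word_in_weyl[of A, OF assms], of i "is"]
  by (simp add: weyl_word_def)

lemma weyl_word_append:
  assumes "\<And>i. A i i = 2"
  shows "weyl_word A (is @ js) = weyl_word A is \<circ> weyl_word A js"
  by (induction "is") (auto simp: weyl_word_Cons[of A, OF assms])

lemma weyl_word_rev:
  assumes "\<And>i. A i i = 2"
  shows "weyl_word A (rev is) (weyl_word A is x) = x"
    and "weyl_word A is (weyl_word A (rev is) x) = x"
  by (induction "is" arbitrary: x)
    (simp_all add: weyl_word_Cons[of A, OF assms] weyl_word_append[of A, OF assms]
      simple_reflection_involutive[of A, OF assms])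

text \<open>Simple reflections are their own inverses, so words without inverses exhaust a generated subgroup.\<close>

lemma parabolic_subgroup_words:
  assumes "\<And>i. A i i = 2"
  shows "parabolic_subgroup A J = weyl_word A ` {is. set is \<subseteq> J}"
proof -
  interpret group "weyl_group A" by (rule group_weyl_group[OF assms])
  have refl: "simple_reflection A i = weyl_word A [i]" for i
    by (simp add: weyl_word_Cons[of A, OF assms])
  have "g \<in> weyl_word A ` {is. set is \<subseteq> J}" if "g \<in> parabolic_subgroup A J" for g
    using that unfolding parabolic_subgroup_def
  proof (induction rule: generate.induct)
    case one
    show ?case by (auto simp: weyl_one intro!: image_eqI[of _ _ "[]"])
  next
    case (incl h)
    then show ?case by (auto simp: refl intro!: imageI)
  next
    case (inv h)
    then obtain i where i: "h = simple_reflection A i" "i \<in> J" by auto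
    have "h \<otimes>\<^bsub>weyl_group A\<^esub> h = \<one>\<^bsub>weyl_group A\<^esub>"
      using weyl_mult[of A, OF assms simple_reflection_in_weyl simple_reflection_in_weyl]
      by (auto simp: i weyl_one fun_eq_iff simple_reflection_involutive[of A, OF assms])
    then have "inv\<^bsub>weyl_group A\<^esub> h = h"
      using i simple_reflection_in_weyl by (intro inv_equality) auto
    then show ?case using i by (auto simp: refl intro!: imageI)
  next
    case (eng g h)
    then obtain "is" js where "g = weyl_word A is" "h = weyl_word A js"
      "set is \<subseteq> J" "set js \<subseteq> J" by auto
    then show ?case
      using weyl_mult[of A, OF assms weyl_word_in_weyl[of A, OF assms] weyl_word_in_weyl[of A, OF assms]]
      by (auto simp: weyl_word_append[of A, OF assms] intro!: image_eqI[of _ _ "is @ js"])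
  qed
  moreover have "weyl_word A is \<in> parabolic_subgroup A J" if "set is \<subseteq> J" for "is"
    using that unfolding parabolic_subgroup_def
    by (induction "is") (auto simp: weyl_word_def intro: generate.intros)
  ultimately show ?thesis by blast
qed

lemma weyl_carrier_words:
  assumes "\<And>i. A i i = 2"
  shows "carrier (weyl_group A) = range (weyl_word A)"
proof -
  interpret B: group "BijGroup (UNIV :: (real ^ 'a) set)" by (rule group_BijGroup)
  have sub: "generate (BijGroup UNIV) (range (simple_reflection A)) \<subseteq> parabolic_subgroup A UNIV"
  proof
    fix g assume "g \<in> generate (BijGroup UNIV) (range (simple_reflection A))"
    then show "g \<in> parabolic_subgroup A UNIV"
    proof (induction rule: generate.induct)
      case one
      show ?case
        using generate.one[of "weyl_group A"] by (simp add: parabolic_subgroup_def weyl_group_def)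
    next
      case (incl h)
      then show ?case by (auto simp: parabolic_subgroup_def intro: generate.incl)
    next
      case (inv h)
      then obtain i where i: "h = simple_reflection A i" by auto
      have "h \<otimes>\<^bsub>BijGroup UNIV\<^esub> h = \<one>\<^bsub>BijGroup UNIV\<^esub>"
        using simple_reflection_bij[of A, OF assms, of i]
        by (auto simp: i BijGroup_def compose_def fun_eq_iff
            simple_reflection_involutive[of A, OF assms])
      then have "inv\<^bsub>BijGroup UNIV\<^esub> h = h"
        using i simple_reflection_bij[of A, OF assms] by (intro B.inv_equality) auto
      then show ?case using i by (auto simp: parabolic_subgroup_def intro: generate.incl)
    next
      case (eng g h)
      then show ?case
        using generate.eng[of g "weyl_group A" _ h]
        by (simp add: parabolic_subgroup_def weyl_group_def)
    qed
  qed
  show ?thesis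
    using sub weyl_word_in_weyl[of A, OF assms] parabolic_subgroup_words[of A UNIV, OF assms]
    by (auto simp: weyl_group_def)
qed

lemma double_coset_words:
  assumes "\<And>i. A i i = 2"
  shows "double_coset (weyl_group A) (parabolic_subgroup A J) (weyl_word A ws) (parabolic_subgroup A K)
    = {weyl_word A (is @ ws @ js) | is js. set is \<subseteq> J \<and> set js \<subseteq> K}"
proof -
  have m: "weyl_word A is \<otimes>\<^bsub>weyl_group A\<^esub> weyl_word A js = weyl_word A (is @ js)" for "is" js
    using weyl_mult[of A, OF assms weyl_word_in_weyl[of A, OF assms] weyl_word_in_weyl[of A, OF assms]]
    by (simp add: weyl_word_append[of A, OF assms])
  show ?thesis
    unfolding double_coset_def r_coset_def set_mult_def parabolic_subgroup_words[of A, OF assms]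
    by (auto simp: m)
qed

section \<open>The stabiliser of a dominant vector\<close>

text \<open>
  The simple reflections of a descending word, applied to \<open>v\<close> from right to left, each subtract a
  positive multiple of a simple root. For dominant \<open>v\<close> such words play the role of reduced words of minimal
  representatives of the cosets of the stabiliser.
\<close>

fun descending :: "('n::finite \<Rightarrow> 'n \<Rightarrow> int) \<Rightarrow> real ^ 'n \<Rightarrow> 'n list \<Rightarrow> bool" where
  "descending A v [] \<longleftrightarrow> True"
| "descending A v (i # is) \<longleftrightarrow> coroot_pairing A i (weyl_word A is v) > 0 \<and> descending A v is"

lemma sum_simple_reflection:
  "(\<Sum>k\<in>UNIV. simple_reflection A i x $ k) = (\<Sum>k\<in>UNIV. x $ k) - coroot_pairing A i x"
proof -
  have "(\<Sum>k\<in>UNIV. simple_reflection A i x $ k)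
      = (\<Sum>k\<in>UNIV. x $ k) - (\<Sum>k\<in>UNIV. if k = i then coroot_pairing A i x else 0)"
    unfolding sum_subtractf[symmetric] simple_reflection_eq
    by (rule sum.cong) (auto simp: axis_def)
  then show ?thesis by simp
qed

lemma simple_reflection_nth_other:
  "j \<noteq> i \<Longrightarrow> simple_reflection A i x $ j = x $ j"
  by (simp add: simple_reflection_eq axis_def)

locale simply_laced =
  fixes A :: "'n::finite \<Rightarrow> 'n \<Rightarrow> int"
  assumes diag: "A i i = 2"
    and sym: "A i j = A j i"
    and off_diag: "i \<noteq> j \<Longrightarrow> A i j = 0 \<or> A i j = -1"
begin

abbreviation "s \<equiv> simple_reflection A"
abbreviation "w \<equiv> weyl_word A"
abbreviation "p \<equiv> coroot_pairing A"

lemmas w_Cons = weyl_word_Cons[of A, OF diag]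
lemmas w_append = weyl_word_append[of A, OF diag]
lemmas w_rev = weyl_word_rev[of A, OF diag]
lemmas s_s = simple_reflection_involutive[of A, OF diag]

lemma descending_sum_less:
  assumes "descending A v is" "is \<noteq> []"
  shows "(\<Sum>k\<in>UNIV. w is v $ k) < (\<Sum>k\<in>UNIV. v $ k)"
  using assms
proof (induction "is")
  case (Cons i "is")
  then show ?case by (cases "is") (auto simp: w_Cons sum_simple_reflection)
qed simp

context
  fixes v :: "real ^ 'n" and J :: "'n set"
  assumes dominant: "p i v \<ge> 0"
    and J_def: "J = {i. p i v = 0}"
begin

lemma orthogonal_word_fixes:
  assumes "set hs \<subseteq> J" shows "w hs v = v"
  using assms by (induction hs) (auto simp: w_Cons J_def simple_reflection_eq)

text \<open>
  Up to right multiplication by the parabolic subgroup of the nodes in \<open>J\<close>, a descending word whose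
  end point lies below its reflection in \<open>\<alpha>\<^sub>i\<close> can be rewritten to start with the letter \<open>i\<close>, and one
  whose end point is orthogonal to \<open>\<alpha>\<^sub>i\<close> absorbs \<open>s\<^sub>i\<close>. For a word \<open>j # ds\<close> with \<open>i\<close> and \<open>j\<close> not
  adjacent, the statement for \<open>ds\<close> is carried across \<open>s\<^sub>j\<close>. For adjacent \<open>i\<close> and \<open>j\<close>, the pairings
  show that \<open>ds\<close> itself can be rewritten to start with \<open>i\<close>, leaving a shorter word to which the induction
  hypothesis for \<open>j\<close> applies; the braid relation then exchanges \<open>i\<close> and \<open>j\<close>. The length in
  the conclusion is what makes this second use of the induction hypothesis legitimate.
\<close>

lemma descending_exchange:
  assumes "descending A v is"
  shows "(p i (w is v) < 0 \<longrightarrow>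
      (\<exists>js hs. descending A v js \<and> length is = Suc (length js) \<and> set hs \<subseteq> J \<and>
        w is = w (i # js @ hs))) \<and>
    (p i (w is v) = 0 \<longrightarrow> (\<exists>hs. set hs \<subseteq> J \<and> w (i # is) = w (is @ hs)))"
  using assms
proof (induction "length is" arbitrary: "is" i rule: less_induct)
  case less
  show ?case
  proof (cases "is")
    case Nil
    then show ?thesis
      using dominant[of i] by (auto simp: J_def intro!: exI[of _ "[i]"])
  next
    case (Cons j ds)
    have ds: "descending A v ds" "p j (w ds v) > 0"
      using less.prems Cons by auto
    have pi: "p i (w is v) = p i (w ds v) - p j (w ds v) * of_int (A i j)"
      by (simp add: Cons w_Cons coroot_pairing_simple_reflection)
    consider "i = j" | "i \<noteq> j" "A i j = 0" | "i \<noteq> j" "A i j = -1"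
      using off_diag by blast
    then show ?thesis
    proof cases
      case 1
      then have "p i (w is v) < 0"
        using pi ds by (simp add: diag)
      moreover have "w is = w (i # ds @ [])" by (simp add: Cons 1)
      ultimately show ?thesis
        using ds Cons by (intro conjI impI exI[of _ ds] exI[of _ "[]"]) auto
    next
      case 2
      have com: "s i (s j x) = s j (s i x)" for x
        using 2 sym[of i j] by (intro simple_reflections_commute) auto
      have pds: "p i (w ds v) = p i (w is v)" using pi 2 by simp
      show ?thesis
      proof (intro conjI impI)
        assume "p i (w is v) < 0"
        then obtain js hs where js: "descending A v js" "length ds = Suc (length js)"
          "set hs \<subseteq> J" "w ds = w (i # js @ hs)"
          using less.hyps[of ds i] ds Cons pds by auto
        have "w ds v = s i (w js v)"
          using js by (simp add: w_Cons w_append orthogonal_word_fixes)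
        then have "p j (w js v) > 0"
          using ds 2 sym[of i j] by (simp add: coroot_pairing_simple_reflection)
        moreover have "w is = w (i # (j # js) @ hs)"
          by (simp add: Cons w_Cons js com fun_eq_iff)
        ultimately show "\<exists>js hs. descending A v js \<and> length is = Suc (length js) \<and> set hs \<subseteq> J \<and>
            w is = w (i # js @ hs)"
          using js Cons by (intro exI[of _ "j # js"] exI[of _ hs]) auto
      next
        assume "p i (w is v) = 0"
        then obtain hs where hs: "set hs \<subseteq> J" "w (i # ds) = w (ds @ hs)"
          using less.hyps[of ds i] ds Cons pds by auto
        have "s i (w ds x) = w (ds @ hs) x" for x
          using fun_cong[OF hs(2), of x] by (simp add: w_Cons)
        then have "w (i # is) = w (is @ hs)"
          by (simp add: Cons w_Cons fun_eq_iff com)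
        then show "\<exists>hs. set hs \<subseteq> J \<and> w (i # is) = w (is @ hs)"
          using hs by blast
      qed
    next
      case 3
      have Aji: "A j i = -1" using 3 sym[of i j] by simp
      have braid: "s i (s j (s i x)) = s j (s i (s j x))" for x
        using 3 Aji diag by (intro simple_reflections_braid) auto
      have "p i (w ds v) = p i (w is v) - p j (w ds v)" using pi 3 by simp
      then have obt: "\<exists>es hs. descending A v es \<and> length ds = Suc (length es) \<and>
          set hs \<subseteq> J \<and> w ds = w (i # es @ hs)" if "p i (w is v) \<le> 0"
        using less.hyps[of ds i] ds Cons that by auto
      have pes: "p j (w es v) = p i (w is v)" "p i (w es v) = p j (w ds v) - p i (w is v)"
        if "w ds = w (i # es @ hs)" "set hs \<subseteq> J" for es hs
      proof -
        have "w es v = s i (w ds v)"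
          using that by (simp add: w_Cons w_append orthogonal_word_fixes s_s)
        then show "p j (w es v) = p i (w is v)" "p i (w es v) = p j (w ds v) - p i (w is v)"
          using pi 3 Aji by (simp_all add: coroot_pairing_simple_reflection diag)
      qed
      show ?thesis
      proof (intro conjI impI)
        assume neg: "p i (w is v) < 0"
        then obtain es hs where es: "descending A v es" "length ds = Suc (length es)"
          "set hs \<subseteq> J" "w ds = w (i # es @ hs)"
          using obt by fastforce
        obtain fs gs where fs: "descending A v fs" "length es = Suc (length fs)"
          "set gs \<subseteq> J" "w es = w (j # fs @ gs)"
          using less.hyps[of es j] es Cons pes[OF es(4,3)] neg by auto
        have "w fs v = s j (w es v)"
          using fs by (simp add: w_Cons w_append orthogonal_word_fixes s_s)
        then have pfs: "p i (w fs v) = p j (w ds v)" "p j (w fs v) = - p i (w is v)"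
          using pes[OF es(4,3)] 3 by (simp_all add: coroot_pairing_simple_reflection diag)
        have "descending A v (j # i # fs)"
          using fs pfs ds neg Aji by (simp add: w_Cons coroot_pairing_simple_reflection)
        moreover have "w is = w (i # (j # i # fs) @ (gs @ hs))"
          by (simp add: Cons w_Cons w_append es fs braid fun_eq_iff)
        ultimately show "\<exists>js hs. descending A v js \<and> length is = Suc (length js) \<and> set hs \<subseteq> J \<and>
            w is = w (i # js @ hs)"
          using es fs Cons by (intro exI[of _ "j # i # fs"] exI[of _ "gs @ hs"]) auto
      next
        assume zero: "p i (w is v) = 0"
        then obtain es hs where es: "descending A v es" "length ds = Suc (length es)"
          "set hs \<subseteq> J" "w ds = w (i # es @ hs)"
          using obt by fastforce
        obtain gs where gs: "set gs \<subseteq> J" "w (j # es) = w (es @ gs)"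
          using less.hyps[of es j] es Cons pes[OF es(4,3)] zero by auto
        have *: "s j (w es x) = w es (w gs x)" for x
          using fun_cong[OF gs(2), of x] by (simp add: w_Cons w_append)
        \<comment> \<open>With \<open>ds = i es hs\<close> and \<open>j es = es gs\<close>: \<open>i j i es hs = j i j es hs = j i es gs hs
          = j ds (hs\<inverse> gs hs)\<close>.\<close>
        have "w (i # is) x = w (is @ (rev hs @ gs @ hs)) x" for x
          by (simp add: Cons w_Cons w_append es braid * w_rev)
        then show "\<exists>hs. set hs \<subseteq> J \<and> w (i # is) = w (is @ hs)"
          using es gs by (intro exI[of _ "rev hs @ gs @ hs"]) (auto simp: fun_eq_iff)
      qed
    qed
  qed
qed

lemma word_factorisation:
  "\<exists>ds hs. descending A v ds \<and> set hs \<subseteq> J \<and> w is = w (ds @ hs)"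
proof (induction "is")
  case Nil
  show ?case by (intro exI[of _ "[]"]) auto
next
  case (Cons i "is")
  then obtain ds hs where ds: "descending A v ds" "set hs \<subseteq> J" "w is = w (ds @ hs)"
    by blast
  consider "p i (w ds v) > 0" | "p i (w ds v) = 0" | "p i (w ds v) < 0" by linarith
  then show ?case
  proof cases
    case 1
    then show ?thesis
      using ds by (intro exI[of _ "i # ds"] exI[of _ hs]) (auto simp: w_Cons)
  next
    case 2
    then obtain gs where "set gs \<subseteq> J" "w (i # ds) = w (ds @ gs)"
      using descending_exchange[OF ds(1)] by blast
    moreover from this have "w (i # is) = w (ds @ gs @ hs)"
      by (simp add: w_Cons w_append ds fun_eq_iff)
    ultimately show ?thesis
      using ds by (intro exI[of _ ds] exI[of _ "gs @ hs"]) auto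
  next
    case 3
    then obtain js gs where "descending A v js" "set gs \<subseteq> J" "w ds = w (i # js @ gs)"
      using descending_exchange[OF ds(1)] by blast
    moreover from this have "w (i # is) = w (js @ gs @ hs)"
      by (simp add: w_Cons w_append ds fun_eq_iff s_s)
    ultimately show ?thesis
      using ds by (intro exI[of _ js] exI[of _ "gs @ hs"]) auto
  qed
qed

text \<open>Each letter of a descending word lowers the coordinate sum, so a non-empty one cannot fix \<open>v\<close>.\<close>

lemma stabiliser_words:
  assumes "w is v = v"
  shows "\<exists>hs. set hs \<subseteq> J \<and> w is = w hs"
proof -
  obtain ds hs where ds: "descending A v ds" "set hs \<subseteq> J" "w is = w (ds @ hs)"
    using word_factorisation by blast
  then have "w ds v = v"
    using assms by (simp add: w_append orthogonal_word_fixes)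
  then have "ds = []"
    using descending_sum_less[OF ds(1)] by force
  then show ?thesis using ds by auto
qed

end

text \<open>The invariant form of a simply laced root system, normalised so that roots have value \<open>2\<close>.\<close>

definition sq_norm :: "real ^ 'n \<Rightarrow> real" where
  "sq_norm x = (\<Sum>k\<in>UNIV. x $ k * p k x)"

lemma sq_norm_simple_reflection: "sq_norm (s i x) = sq_norm x"
proof -
  define c where "c = p i x"
  have a: "(\<Sum>k\<in>UNIV. x $ k * of_int (A k i)) = c"
    unfolding c_def coroot_pairing_def by (rule sum.cong) (auto simp: sym[of _ i])
  have "sq_norm (s i x)
      = (\<Sum>k\<in>UNIV. x $ k * p k x - c * (x $ k * of_int (A k i))
          - (if k = i then c * (p i x - c * 2) else 0))"
    unfolding sq_norm_def coroot_pairing_simple_reflection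
    by (rule sum.cong)
      (auto simp: simple_reflection_eq axis_def diag algebra_simps simp flip: c_def)
  also have "\<dots> = sq_norm x"
    by (simp add: sum_subtractf sq_norm_def a flip: sum_distrib_left) (simp add: c_def algebra_simps)
  finally show ?thesis .
qed

end

section \<open>Vectors of norm two in type \<open>E\<^sub>6\<close>\<close>

interpretation E6: simply_laced cartan_E6
  by unfold_locales (auto simp: cartan_E6_def insert_commute)

definition coords_E6 :: "real \<Rightarrow> real \<Rightarrow> real \<Rightarrow> real \<Rightarrow> real \<Rightarrow> real \<Rightarrow> real ^ 6" where
  "coords_E6 a b c d e f =
    (\<chi> i. if i = 1 then a else if i = 2 then b else if i = 3 then c
      else if i = 4 then d else if i = 5 then e else f)"

lemma coords_E6_nth:
  "coords_E6 a b c d e f $ 1 = a" "coords_E6 a b c d e f $ 2 = b" "coords_E6 a b c d e f $ 3 = c"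
  "coords_E6 a b c d e f $ 4 = d" "coords_E6 a b c d e f $ 5 = e" "coords_E6 a b c d e f $ 6 = f"
  by (simp_all add: coords_E6_def)

lemma all_E6: "(\<forall>i::6. P i) \<longleftrightarrow> P 1 \<and> P 2 \<and> P 3 \<and> P 4 \<and> P 5 \<and> P 6"
  using labels_E6(2) by (metis UNIV_I empty_iff insert_iff)

lemma sum_E6: "(\<Sum>i\<in>UNIV. f (i::6)) = f 1 + f 2 + f 3 + f 4 + f 5 + (f 6 :: real)"
  unfolding labels_E6(2) using labels_E6(1) by (simp add: add_ac)

lemma pairing_E6:
  "E6.p 1 x = 2 * x $ 1 - x $ 3"
  "E6.p 2 x = 2 * x $ 2 - x $ 4"
  "E6.p 3 x = 2 * x $ 3 - x $ 1 - x $ 4"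
  "E6.p 4 x = 2 * x $ 4 - x $ 2 - x $ 3 - x $ 5"
  "E6.p 5 x = 2 * x $ 5 - x $ 4 - x $ 6"
  "E6.p 6 x = 2 * x $ 6 - x $ 5"
  by (simp_all add: coroot_pairing_def sum_E6 cartan_E6_def edges_E6_def doubleton_eq_iff)

lemma reflection_coords_E6:
  "E6.s 1 (coords_E6 a b c d e f) = coords_E6 (c - a) b c d e f"
  "E6.s 2 (coords_E6 a b c d e f) = coords_E6 a (d - b) c d e f"
  "E6.s 3 (coords_E6 a b c d e f) = coords_E6 a b (a + d - c) d e f"
  "E6.s 4 (coords_E6 a b c d e f) = coords_E6 a b c (b + c + e - d) e f"
  "E6.s 5 (coords_E6 a b c d e f) = coords_E6 a b c d (d + f - e) f"
  "E6.s 6 (coords_E6 a b c d e f) = coords_E6 a b c d e (e - f)"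
  unfolding vec_eq_iff all_E6 simple_reflection_eq pairing_E6 coords_E6_nth
  by (simp_all add: coords_E6_nth[simplified] axis_def)

definition "highest_root_E6 = coords_E6 1 2 2 3 2 1"

abbreviation "nodes_A5 \<equiv> {1, 3, 4, 5, 6 :: 6}"

lemma highest_root_pairing:
  "E6.p i highest_root_E6 \<ge> 0" "nodes_A5 = {i. E6.p i highest_root_E6 = 0}"
proof -
  have "\<forall>i. E6.p i highest_root_E6 = (if i = 2 then 1 else 0)"
    unfolding all_E6 pairing_E6 highest_root_E6_def coords_E6_nth by simp
  moreover have "nodes_A5 = {i. i \<noteq> 2}"
    using labels_E6 by auto
  ultimately show "E6.p i highest_root_E6 \<ge> 0" "nodes_A5 = {i. E6.p i highest_root_E6 = 0}"
    by auto
qed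

lemmas stabiliser_E6 = E6.stabiliser_words[OF highest_root_pairing]
lemmas nodes_A5_fix = E6.orthogonal_word_fixes[OF highest_root_pairing]

definition norm_two_integral :: "real ^ 6 \<Rightarrow> bool" where
  "norm_two_integral x \<longleftrightarrow> (\<forall>i. x $ i \<in> \<int>) \<and> E6.sq_norm x = 2"

lemma integral_pairing:
  assumes "\<And>i. x $ i \<in> \<int>" shows "coroot_pairing A i x \<in> \<int>"
  unfolding coroot_pairing_def using assms by auto

lemma norm_two_integral_word:
  "norm_two_integral x \<Longrightarrow> norm_two_integral (E6.w is x)"
proof (induction "is")
  case (Cons i "is")
  then show ?case
    using integral_pairing[of "E6.w is x" cartan_E6 i]
    by (auto simp: norm_two_integral_def E6.w_Cons E6.sq_norm_simple_reflection)
       (auto simp: simple_reflection_eq axis_def)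
qed simp

text \<open>
  Completing squares along the three arms of the diagram, from the ends towards node \<open>4\<close>, leaves the
  coefficient \<open>1/6\<close> there. This gives explicit bounds for the coordinates of vectors of norm two.
\<close>

lemma sq_norm_E6:
  "E6.sq_norm x = 2 * (x $ 1 - x $ 3 / 2)\<^sup>2 + 3 / 2 * (x $ 3 - 2 * x $ 4 / 3)\<^sup>2
    + 2 * (x $ 6 - x $ 5 / 2)\<^sup>2 + 3 / 2 * (x $ 5 - 2 * x $ 4 / 3)\<^sup>2
    + 2 * (x $ 2 - x $ 4 / 2)\<^sup>2 + (x $ 4)\<^sup>2 / 6"
  unfolding E6.sq_norm_def sum_E6 pairing_E6
  by (simp only: power2_eq_square) (simp add: field_simps)

lemma norm_two_sum_bounded:
  assumes "E6.sq_norm x = 2"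
  shows "(\<Sum>k\<in>UNIV. x $ k) \<le> 25"
proof -
  note nn = zero_le_power2[of "x $ 1 - x $ 3 / 2"] zero_le_power2[of "x $ 3 - 2 * x $ 4 / 3"]
    zero_le_power2[of "x $ 6 - x $ 5 / 2"] zero_le_power2[of "x $ 5 - 2 * x $ 4 / 3"]
    zero_le_power2[of "x $ 2 - x $ 4 / 2"] zero_le_power2[of "x $ 4"]
  note eq = assms[unfolded sq_norm_E6]
  have bound: "y \<le> n" if "y\<^sup>2 \<le> n * n" "0 \<le> n" for y n :: real
    using that power2_le_imp_le[of y n] by (simp add: power2_eq_square)
  have "x $ 1 - x $ 3 / 2 \<le> 1" "x $ 6 - x $ 5 / 2 \<le> 1" "x $ 2 - x $ 4 / 2 \<le> 1"
    "x $ 3 - 2 * x $ 4 / 3 \<le> 2" "x $ 5 - 2 * x $ 4 / 3 \<le> 2" "x $ 4 \<le> 4"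
    by (rule bound; use eq nn in linarith)+
  then show ?thesis unfolding sum_E6 by linarith
qed

text \<open>
  A reflection in a simple root with negative pairing raises the integral coordinate sum, which is
  bounded on vectors of norm two.
\<close>

lemma exists_A5_dominant_conjugate:
  assumes "norm_two_integral x"
  shows "\<exists>is. set is \<subseteq> nodes_A5 \<and> (\<forall>i\<in>nodes_A5. E6.p i (E6.w is x) \<ge> 0)"
  using assms
proof (induction "nat (25 - \<lfloor>\<Sum>k\<in>UNIV. x $ k\<rfloor>)" arbitrary: x rule: less_induct)
  case less
  show ?case
  proof (cases "\<forall>i\<in>nodes_A5. E6.p i x \<ge> 0")
    case True
    then show ?thesis by (intro exI[of _ "[]"]) auto
  next
    case False
    then obtain i where i: "i \<in> nodes_A5" "E6.p i x < 0" by force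
    have int: "\<And>i. x $ i \<in> \<int>" using less.prems by (auto simp: norm_two_integral_def)
    obtain n where n: "E6.p i x = of_int n"
      using integral_pairing[OF int] Ints_cases by metis
    have ni: "norm_two_integral (E6.s i x)"
      using norm_two_integral_word[OF less.prems, of "[i]"] by (simp add: E6.w_Cons)
    have le: "\<lfloor>\<Sum>k\<in>UNIV. E6.s i x $ k\<rfloor> \<le> 25"
      using norm_two_sum_bounded[of "E6.s i x"] ni by (simp add: norm_two_integral_def floor_le_iff)
    have "(\<Sum>k\<in>UNIV. E6.s i x $ k) = (\<Sum>k\<in>UNIV. x $ k) - of_int n"
      by (simp add: sum_simple_reflection n)
    moreover have "n < 0" using i n by simp
    ultimately have "\<lfloor>\<Sum>k\<in>UNIV. x $ k\<rfloor> < \<lfloor>\<Sum>k\<in>UNIV. E6.s i x $ k\<rfloor>" by simp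
    then have "nat (25 - \<lfloor>\<Sum>k\<in>UNIV. E6.s i x $ k\<rfloor>) < nat (25 - \<lfloor>\<Sum>k\<in>UNIV. x $ k\<rfloor>)"
      using le by linarith
    from less.hyps[OF this ni] obtain "is" where "set is \<subseteq> nodes_A5"
      "\<forall>j\<in>nodes_A5. E6.p j (E6.w is (E6.s i x)) \<ge> 0" by blast
    then show ?thesis
      using i by (intro exI[of _ "is @ [i]"]) (auto simp: E6.w_append E6.w_Cons)
  qed
qed

text \<open>
  The orthogonal decomposition along \<open>A\<^sub>5\<close>: the component orthogonal to \<open>A\<^sub>5\<close> has squared length
  \<open>c\<^sup>2 / 2\<close>, where \<open>c = x $ 2\<close>, and the form in the pairings \<open>a i\<close> is six times the inverse
  Cartan matrix of \<open>A\<^sub>5\<close>.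
\<close>

lemma six_sq_norm_E6:
  fixes x :: "real ^ 6"
  defines "a \<equiv> \<lambda>i. E6.p i x"
  shows "6 * E6.sq_norm x = 3 * (x $ 2)\<^sup>2
    + 5 * (a 1)\<^sup>2 + 8 * (a 3)\<^sup>2 + 9 * (a 4)\<^sup>2 + 8 * (a 5)\<^sup>2 + 5 * (a 6)\<^sup>2
    + 8 * (a 1 * a 3) + 6 * (a 1 * a 4) + 4 * (a 1 * a 5) + 2 * (a 1 * a 6)
    + 12 * (a 3 * a 4) + 8 * (a 3 * a 5) + 4 * (a 3 * a 6)
    + 12 * (a 4 * a 5) + 6 * (a 4 * a 6) + 8 * (a 5 * a 6)"
  unfolding a_def E6.sq_norm_def sum_E6 pairing_E6 by algebra

text \<open>
  All entries of the inverse Cartan matrix are positive, so for non-negative weights each term is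
  bounded by the total \<open>12\<close>. The weights that remain are those of the trivial representation of
  \<open>SL\<^sub>6\<close> (\<open>c = \<plusminus>2\<close>), of its third exterior power (\<open>c = \<plusminus>1\<close>) and of its adjoint representation
  (\<open>c = 0\<close>).
\<close>

lemma A5_weights_small_norm:
  fixes c a b d e f :: int
  assumes nn: "a \<ge> 0" "b \<ge> 0" "d \<ge> 0" "e \<ge> 0" "f \<ge> 0"
    and eq: "12 = 3 * c\<^sup>2 + 5 * a\<^sup>2 + 8 * b\<^sup>2 + 9 * d\<^sup>2 + 8 * e\<^sup>2 + 5 * f\<^sup>2
      + 8 * (a * b) + 6 * (a * d) + 4 * (a * e) + 2 * (a * f)
      + 12 * (b * d) + 8 * (b * e) + 4 * (b * f) + 12 * (d * e) + 6 * (d * f) + 8 * (e * f)"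
  shows "(c, a, b, d, e, f) \<in>
    {(2, 0, 0, 0, 0, 0), (1, 0, 0, 1, 0, 0), (0, 1, 0, 0, 0, 1), (-1, 0, 0, 1, 0, 0), (-2, 0, 0, 0, 0, 0)}"
proof -
  have prods: "a * b \<ge> 0" "a * d \<ge> 0" "a * e \<ge> 0" "a * f \<ge> 0" "b * d \<ge> 0" "b * e \<ge> 0" "b * f \<ge> 0"
    "d * e \<ge> 0" "d * f \<ge> 0" "e * f \<ge> 0" using nn by auto
  note sqs = zero_le_power2[of a] zero_le_power2[of b] zero_le_power2[of c] zero_le_power2[of d]
    zero_le_power2[of e] zero_le_power2[of f]
  have bound: "y < n" if "y\<^sup>2 < n * n" "0 \<le> n" for y n :: int
    using that power2_less_imp_less[of y n] by (simp add: power2_eq_square)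
  have "a < 2" "b < 2" "d < 2" "e < 2" "f < 2" "c < 3"
    by (rule bound; use eq prods sqs in linarith)+
  moreover have "- c < 3"
    by (rule bound; use eq prods sqs in \<open>simp only: power2_minus; linarith\<close>)
  ultimately have "a = 0 \<or> a = 1" "b = 0 \<or> b = 1" "d = 0 \<or> d = 1" "e = 0 \<or> e = 1" "f = 0 \<or> f = 1"
    "c = -2 \<or> c = -1 \<or> c = 0 \<or> c = 1 \<or> c = 2"
    using nn by linarith+
  then show ?thesis
    using eq by (elim disjE) simp_all
qed

definition dominant_E6 :: "(real ^ 6) list" where
  "dominant_E6 = [coords_E6 1 2 2 3 2 1, coords_E6 1 1 2 3 2 1, coords_E6 1 0 1 1 1 1,
     coords_E6 0 (-1) 0 0 0 0, coords_E6 (-1) (-2) (-2) (-3) (-2) (-1)]"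

lemma A5_dominant_in_list:
  assumes "norm_two_integral x" "\<forall>i\<in>nodes_A5. E6.p i x \<ge> 0"
  shows "x \<in> set dominant_E6"
proof -
  have int: "\<And>i. x $ i \<in> \<int>" using assms by (auto simp: norm_two_integral_def)
  obtain c where c: "x $ 2 = of_int c" using int Ints_cases by metis
  have "\<forall>i. \<exists>n. E6.p i x = of_int n" using integral_pairing[OF int] Ints_cases by metis
  then obtain a where a: "\<And>i. E6.p i x = of_int (a i)" by metis
  have nn: "a 1 \<ge> 0" "a 3 \<ge> 0" "a 4 \<ge> 0" "a 5 \<ge> 0" "a 6 \<ge> 0"
    using assms(2) unfolding a by (simp_all del: One_nat_def)
  have "(c, a 1, a 3, a 4, a 5, a 6) \<in>
    {(2, 0, 0, 0, 0, 0), (1, 0, 0, 1, 0, 0), (0, 1, 0, 0, 0, 1), (-1, 0, 0, 1, 0, 0), (-2, 0, 0, 0, 0, 0)}"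
  proof (rule A5_weights_small_norm[OF nn])
    have "E6.sq_norm x = 2" using assms by (simp add: norm_two_integral_def)
    then have norm: "12 = 6 * E6.sq_norm x" by simp
    show "12 = 3 * c\<^sup>2
      + 5 * (a 1)\<^sup>2 + 8 * (a 3)\<^sup>2 + 9 * (a 4)\<^sup>2 + 8 * (a 5)\<^sup>2 + 5 * (a 6)\<^sup>2
      + 8 * (a 1 * a 3) + 6 * (a 1 * a 4) + 4 * (a 1 * a 5) + 2 * (a 1 * a 6)
      + 12 * (a 3 * a 4) + 8 * (a 3 * a 5) + 4 * (a 3 * a 6)
      + 12 * (a 4 * a 5) + 6 * (a 4 * a 6) + 8 * (a 5 * a 6)"
      by (rule of_int_eq_iff[where 'a = real, THEN iffD1],
          unfold of_int_add of_int_mult of_int_power of_int_numeral,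
          rule norm[unfolded six_sq_norm_E6 a c])
  qed
  \<comment> \<open>Inverting the Cartan matrix of \<open>A\<^sub>5\<close>; the coefficient of \<open>\<alpha>\<^sub>2\<close> enters through the pairing at node \<open>4\<close>.\<close>
  moreover have
    "x $ 1 = (3 * of_int c + 5 * of_int (a 1) + 4 * of_int (a 3) + 3 * of_int (a 4)
      + 2 * of_int (a 5) + of_int (a 6)) / 6"
    "x $ 3 = (6 * of_int c + 4 * of_int (a 1) + 8 * of_int (a 3) + 6 * of_int (a 4)
      + 4 * of_int (a 5) + 2 * of_int (a 6)) / 6"
    "x $ 4 = (9 * of_int c + 3 * of_int (a 1) + 6 * of_int (a 3) + 9 * of_int (a 4)
      + 6 * of_int (a 5) + 3 * of_int (a 6)) / 6"
    "x $ 5 = (6 * of_int c + 2 * of_int (a 1) + 4 * of_int (a 3) + 6 * of_int (a 4)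
      + 8 * of_int (a 5) + 4 * of_int (a 6)) / 6"
    "x $ 6 = (3 * of_int c + of_int (a 1) + 2 * of_int (a 3) + 3 * of_int (a 4)
      + 4 * of_int (a 5) + 5 * of_int (a 6)) / 6"
    unfolding a[symmetric] pairing_E6 c[symmetric] by (simp_all add: field_simps)
  ultimately show ?thesis
    unfolding dominant_E6_def list.set insert_iff vec_eq_iff all_E6 coords_E6_nth c prod.inject
    by (elim disjE) simp_all
qed

section \<open>Double cosets as orbits of the highest root\<close>

abbreviation "reps_E6 \<equiv>
      [[],
       [2],
       [2, 4, 3, 5, 4, 2],
       [2, 4, 3, 1, 5, 4, 3, 6, 5, 4, 2],
       [2, 4, 3, 1, 5, 4, 2, 3, 4, 5, 6, 5, 4, 2, 3, 1, 4, 3, 5, 4, 2]] :: 6 list list"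

lemma reps_highest_root: "map (\<lambda>t. E6.w t highest_root_E6) reps_E6 = dominant_E6"
  by (simp add: E6.w_Cons highest_root_E6_def dominant_E6_def reflection_coords_E6)

lemma nodes_A5_level: "set is \<subseteq> nodes_A5 \<Longrightarrow> E6.w is x $ 2 = x $ 2"
  by (induction "is") (auto simp: E6.w_Cons simple_reflection_nth_other)

abbreviation "A5_double_coset t \<equiv> double_coset (weyl_group cartan_E6)
    (parabolic_subgroup cartan_E6 nodes_A5) (E6.w t) (parabolic_subgroup cartan_E6 nodes_A5)"

lemma double_coset_level:
  assumes "A5_double_coset t = A5_double_coset u"
  shows "E6.w t highest_root_E6 $ 2 = E6.w u highest_root_E6 $ 2"
proof -
  have "E6.w t \<in> A5_double_coset t"
    unfolding double_coset_words[of cartan_E6, OF E6.diag]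
    by (intro CollectI exI[of _ "[]"]) simp
  then have "E6.w t \<in> A5_double_coset u"
    using assms by simp
  then obtain "is" js where "E6.w t = E6.w (is @ u @ js)" "set is \<subseteq> nodes_A5" "set js \<subseteq> nodes_A5"
    unfolding double_coset_words[of cartan_E6, OF E6.diag] by blast
  then show ?thesis by (simp add: E6.w_append nodes_A5_fix nodes_A5_level)
qed

text \<open>
  If \<open>h \<in> H\<close> carries \<open>u \<theta>\<close> to \<open>t \<theta>\<close>, then \<open>t\<inverse> h u\<close> fixes \<open>\<theta>\<close> and therefore lies in \<open>H\<close>.
\<close>

lemma double_coset_subsetI:
  assumes is_A5: "set is \<subseteq> nodes_A5"
    and eq: "E6.w is (E6.w u highest_root_E6) = E6.w t highest_root_E6"
  shows "A5_double_coset u \<subseteq> A5_double_coset t"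
proof -
  have "E6.w (rev t @ is @ u) highest_root_E6 = highest_root_E6"
    using eq by (simp add: E6.w_append E6.w_rev)
  then obtain hs where hs: "set hs \<subseteq> nodes_A5" "E6.w (rev t @ is @ u) = E6.w hs"
    using stabiliser_E6 by blast
  have u: "E6.w u x = E6.w (rev is @ t @ hs) x" for x
    by (simp add: E6.w_append E6.w_rev flip: hs(2))
  show ?thesis
    unfolding double_coset_words[of cartan_E6, OF E6.diag]
  proof
    fix g assume "g \<in> {E6.w (is @ u @ js) |is js. set is \<subseteq> nodes_A5 \<and> set js \<subseteq> nodes_A5}"
    then obtain ks js where "g = E6.w (ks @ u @ js)" "set ks \<subseteq> nodes_A5" "set js \<subseteq> nodes_A5" by blast
    then show "g \<in> {E6.w (is @ t @ js) |is js. set is \<subseteq> nodes_A5 \<and> set js \<subseteq> nodes_A5}"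
      using hs(1) is_A5
      by (intro CollectI exI[of _ "ks @ rev is"] exI[of _ "hs @ js"])
         (simp add: fun_eq_iff E6.w_append u)
  qed
qed

lemma double_coset_eqI:
  assumes "set is \<subseteq> nodes_A5"
    and eq: "E6.w is (E6.w u highest_root_E6) = E6.w t highest_root_E6"
  shows "A5_double_coset u = A5_double_coset t"
proof (rule subset_antisym)
  show "A5_double_coset u \<subseteq> A5_double_coset t"
    using assms by (rule double_coset_subsetI)
  show "A5_double_coset t \<subseteq> A5_double_coset u"
    using assms(1) by (intro double_coset_subsetI[of "rev is"]) (simp_all add: E6.w_rev flip: eq)
qed

lemma double_coset_has_representative:
  "\<exists>t\<in>set reps_E6. A5_double_coset u = A5_double_coset t"
proof -
  have "norm_two_integral highest_root_E6"
    unfolding norm_two_integral_def all_E6 E6.sq_norm_def sum_E6 pairing_E6 highest_root_E6_def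
      coords_E6_nth by simp
  then have n: "norm_two_integral (E6.w u highest_root_E6)"
    by (rule norm_two_integral_word)
  obtain "is" where "is": "set is \<subseteq> nodes_A5"
    "\<forall>i\<in>nodes_A5. E6.p i (E6.w is (E6.w u highest_root_E6)) \<ge> 0"
    using exists_A5_dominant_conjugate[OF n] by blast
  have "E6.w is (E6.w u highest_root_E6) \<in> set dominant_E6"
    using A5_dominant_in_list[OF norm_two_integral_word[OF n] "is"(2)] .
  then obtain t where "t \<in> set reps_E6"
    "E6.w is (E6.w u highest_root_E6) = E6.w t highest_root_E6"
    unfolding reps_highest_root[symmetric] set_map by blast
  then show ?thesis using double_coset_eqI[OF "is"(1)] by blast
qed

theorem mainTheorem7:
  shows "double_coset_representatives
    (weyl_group cartan_E6)
    (parabolic_subgroup cartan_E6 {1, 3, 4, 5, 6})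
    (parabolic_subgroup cartan_E6 {1, 3, 4, 5, 6})
    (map (weyl_word cartan_E6)
      [[],
       [2],
       [2, 4, 3, 5, 4, 2],
       [2, 4, 3, 1, 5, 4, 3, 6, 5, 4, 2],
       [2, 4, 3, 1, 5, 4, 2, 3, 4, 5, 6, 5, 4, 2, 3, 1, 4, 3, 5, 4, 2]])"
proof -
  define ts where "ts = reps_E6"
  have lev: "map (\<lambda>t. E6.w t highest_root_E6 $ 2) ts = [2, 1, 0, -1, -2]"
    using arg_cong[OF reps_highest_root, of "map (\<lambda>x. x $ 2)"]
    unfolding dominant_E6_def ts_def list.map coords_E6_nth o_def by simp
  have "inj_on (\<lambda>k. A5_double_coset (ts ! k)) {..<length ts}"
  proof (rule inj_onI)
    fix k l assume kl: "k \<in> {..<length ts}" "l \<in> {..<length ts}"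
      and "A5_double_coset (ts ! k) = A5_double_coset (ts ! l)"
    note level = double_coset_level[OF this(3)]
    have "distinct (map (\<lambda>t. E6.w t highest_root_E6 $ 2) ts)"
      unfolding lev by simp
    from nth_eq_iff_index_eq[OF this, of k l] kl level show "k = l"
      by simp
  qed
  moreover have "(\<lambda>k. A5_double_coset (ts ! k)) ` {..<length ts} = (\<lambda>t. A5_double_coset t) ` set ts"
    by (auto simp: set_conv_nth)
  moreover have "\<dots> = range (\<lambda>u. A5_double_coset u)"
    using double_coset_has_representative unfolding ts_def by blast
  moreover have "\<dots> = double_cosets (weyl_group cartan_E6)
      (parabolic_subgroup cartan_E6 nodes_A5) (parabolic_subgroup cartan_E6 nodes_A5)"
    unfolding double_cosets_def weyl_carrier_words[of cartan_E6, OF E6.diag] by (simp add: image_image)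
  ultimately have "bij_betw (\<lambda>k. A5_double_coset (ts ! k)) {..<length ts}
      (double_cosets (weyl_group cartan_E6)
        (parabolic_subgroup cartan_E6 nodes_A5) (parabolic_subgroup cartan_E6 nodes_A5))"
    by (simp only: bij_betw_def)
  then have "bij_betw (\<lambda>k. double_coset (weyl_group cartan_E6)
      (parabolic_subgroup cartan_E6 nodes_A5) (map E6.w ts ! k) (parabolic_subgroup cartan_E6 nodes_A5))
      {..<length (map E6.w ts)} (double_cosets (weyl_group cartan_E6)
        (parabolic_subgroup cartan_E6 nodes_A5) (parabolic_subgroup cartan_E6 nodes_A5))"
    by (subst bij_betw_cong) auto
  moreover have "set (map E6.w ts) \<subseteq> carrier (weyl_group cartan_E6)"
    using weyl_word_in_weyl[of cartan_E6, OF E6.diag] by auto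
  ultimately show ?thesis
    unfolding double_coset_representatives_def ts_def by blast
qed

end
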